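(* Let $\{(A_n,p_n)\}_{n\in\mathbb{N}}$ be a rare-events source with support interval $C$ and limit distribution $P$. Let $\tilde P_n$, $n\in\mathbb{N}$, be random probability measures on $\mathbb{R}^+$, where $\tilde P_n$ is constructed from the samples $X_{n,1},\dots,X_{n,n}$, such that for some $s>0$, $n^s d_{\mathrm W}(\tilde P_n,P)\to0$ almost surely. Let $D_n=n^{s}$ and $$\hat Y_n^H=-\int_{\mathbb{R}^+}\log_{D_n}x\,\mathrm{d}\tilde P_n(x),\qquad \hat Y_n^p=-\hat Y_n^H,$$ where $\log_{D}$ denotes the $D$-tapered version of the natural logarithm (not a logarithm in base $D$). Then: (1) $\hat Y_n^H$ is a consistent estimator of the normalized entropy $Y_n^H=H(p_n)-\log n$: $\hat Y_n^H\to-\int_C\log x\,\mathrm{d}P(x)$ almost surely and $Y_n^H\to-\int_C\log x\,\mathrm{d}P(x)$. (2) $\hat Y_n^p$ is a consistent estimator of the normalized log-probability of the observed sequence $Y_n^p=\frac1n\log p_n(X_{n,1},\dots,X_{n,n})+\log n$: $\hat Y_n^p\to\int_C\log x\,\mathrm{d}P(x)$ almost surely and $Y_n^p\to\int_C\log x\,\mathrm{d}P(x)$ almost surely.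
   Context: Rare-events source: a sequence $\{(A_n,p_n)\}_{n\in\mathbb{N}}$, where $A_n$ is a finite alphabet and $p_n$ a probability mass function on $A_n$, such that, with $X_n\sim p_n$, $Z_n=n\,p_n(X_n)$ and $P_n$ the distribution of $Z_n$: (i) there is an interval $C=[\check c,\hat c]$ with $0<\check c\le\hat c<\infty$ such that $\check c/n\le p_n(a)\le\hat c/n$ for all $n$ and all $a\in A_n$; (ii) there is a probability distribution $P$ with $P_n\Rightarrow P$ weakly (so $P$ is supported on $C$). Sampling: for each $n$, $X_{n,1},\dots,X_{n,n}$ are i.i.d. from $p_n$; all samples live on a common probability space. $p_n(X_{n,1},\dots,X_{n,n})=\prod_{i=1}^n p_n(X_{n,i})$ is the probability of the observed sequence, and $H(p_n)=-\sum_{a\in A_n}p_n(a)\log p_n(a)$. Tapered function: for a real-valued function $g$ on $(0,\infty)$ and $D\ge1$, the $D$-tapered version $g_D$ is defined on $\mathbb{R}^+=[0,\infty)$ by $g_D(x)=g(D^{-1})$ for $x<D^{-1}$, $g_D(x)=g(x)$ for $x\in[D^{-1},D]$, and $g_D(x)=g(D)$ for $x>D$. The Wasserstein distance between probability measures on $\mathbb{R}^+$ is $d_{\mathrm W}(Q_1,Q_2)=\int_{\mathbb{R}^+}|F(x;Q_1)-F(x;Q_2)|\,\mathrm{d}x$, where $F(\cdot;Q)$ is the cumulative distribution function of $Q$. *)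

theory Defs
  imports "HOL-Probability.Probability"
begin

text \<open>
  Indices are natural numbers \<open>n \<ge> 1\<close>; objects with index \<open>0\<close> are unconstrained. The alphabets are
  finite subsets of one arbitrary ambient type.
\<close>

definition rare_law :: "(nat \<Rightarrow> 'a pmf) \<Rightarrow> nat \<Rightarrow> real measure" where
  "rare_law p n = distr (measure_pmf (p n)) borel (\<lambda>a. real n * pmf (p n) a)"

text \<open>That \<open>P\<close> is supported on the interval is a consequence of the definition, not a requirement.\<close>

definition rare_events_source ::
  "(nat \<Rightarrow> 'a set) \<Rightarrow> (nat \<Rightarrow> 'a pmf) \<Rightarrow> real \<Rightarrow> real \<Rightarrow> real measure \<Rightarrow> bool" where
  "rare_events_source A p cl cu P \<longleftrightarrow>
     (\<forall>n\<ge>1. finite (A n) \<and> set_pmf (p n) \<subseteq> A n) \<and>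
     0 < cl \<and> cl \<le> cu \<and>
     (\<forall>n\<ge>1. \<forall>a\<in>A n. cl / real n \<le> pmf (p n) a \<and> pmf (p n) a \<le> cu / real n) \<and>
     real_distribution P \<and> weak_conv_m (rare_law p) P"

text \<open>
  Independence is required within each row \<open>X n 1, \<dots>, X n n\<close> only; nothing is assumed about the
  joint law of different rows.
\<close>

definition iid_rows ::
  "'w measure \<Rightarrow> (nat \<Rightarrow> 'a pmf) \<Rightarrow> (nat \<Rightarrow> nat \<Rightarrow> 'w \<Rightarrow> 'a) \<Rightarrow> bool" where
  "iid_rows M p X \<longleftrightarrow> prob_space M \<and>
     (\<forall>n\<ge>1. prob_space.indep_vars M (\<lambda>_. count_space UNIV) (X n) {1..n} \<and>
       (\<forall>i\<in>{1..n}. distr M (count_space UNIV) (X n i) = measure_pmf (p n)))"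

definition sample :: "(nat \<Rightarrow> nat \<Rightarrow> 'w \<Rightarrow> 'a) \<Rightarrow> nat \<Rightarrow> 'w \<Rightarrow> 'a list" where
  "sample X n \<omega> = map (\<lambda>i. X n i \<omega>) [1..<Suc n]"

text \<open>Probability measures on \<open>[0, \<infinity>)\<close> are Borel measures on the whole line giving it mass one.\<close>

definition nonneg_distribution :: "real measure \<Rightarrow> bool" where
  "nonneg_distribution Q \<longleftrightarrow> real_distribution Q \<and> measure Q {0..} = 1"

text \<open>
  A random probability measure constructed from the samples is a function \<open>T n\<close> of the sample:
  its value at \<open>\<omega>\<close> is \<open>T n (sample X n \<omega>)\<close>. Measurability is automatic since \<open>A n\<close> is finite.
\<close>

definition measure_estimator :: "(nat \<Rightarrow> 'a set) \<Rightarrow> (nat \<Rightarrow> 'a list \<Rightarrow> real measure) \<Rightarrow> bool" where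
  "measure_estimator A T \<longleftrightarrow>
     (\<forall>n\<ge>1. \<forall>xs\<in>lists (A n). length xs = n \<longrightarrow> nonneg_distribution (T n xs))"

text \<open>Valued in \<open>ennreal\<close>, since the distance is infinite when, e.g., only one mean is infinite.\<close>

definition wasserstein :: "real measure \<Rightarrow> real measure \<Rightarrow> ennreal" where
  "wasserstein Q R = (\<integral>\<^sup>+x\<in>{0..}. ennreal \<bar>cdf Q x - cdf R x\<bar> \<partial>lborel)"

definition tapered :: "(real \<Rightarrow> real) \<Rightarrow> real \<Rightarrow> real \<Rightarrow> real" where
  "tapered g D x = (if x < 1 / D then g (1 / D) else if x \<le> D then g x else g D)"

definition entropy_estimate :: "real \<Rightarrow> nat \<Rightarrow> real measure \<Rightarrow> real" where
  "entropy_estimate s n Q = - (LINT x:{0..}|Q. tapered ln (real n powr s) x)"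

definition logprob_estimate :: "real \<Rightarrow> nat \<Rightarrow> real measure \<Rightarrow> real" where
  "logprob_estimate s n Q = - entropy_estimate s n Q"

definition pmf_entropy :: "'a set \<Rightarrow> 'a pmf \<Rightarrow> real" where
  "pmf_entropy B q = - (\<Sum>a\<in>B. pmf q a * ln (pmf q a))"

definition normalized_entropy :: "(nat \<Rightarrow> 'a set) \<Rightarrow> (nat \<Rightarrow> 'a pmf) \<Rightarrow> nat \<Rightarrow> real" where
  "normalized_entropy A p n = pmf_entropy (A n) (p n) - ln (real n)"

definition seq_prob :: "'a pmf \<Rightarrow> 'a list \<Rightarrow> real" where
  "seq_prob q xs = (\<Prod>x\<leftarrow>xs. pmf q x)"

definition normalized_logprob :: "(nat \<Rightarrow> 'a pmf) \<Rightarrow> nat \<Rightarrow> 'a list \<Rightarrow> real" where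
  "normalized_logprob p n xs = ln (seq_prob (p n) xs) / real n + ln (real n)"

definition consistent_estimator ::
  "'w measure \<Rightarrow> (nat \<Rightarrow> 'w \<Rightarrow> real) \<Rightarrow> (nat \<Rightarrow> 'w \<Rightarrow> real) \<Rightarrow> bool" where
  "consistent_estimator M Yhat Y \<longleftrightarrow> (AE \<omega> in M. (\<lambda>n. Yhat n \<omega> - Y n \<omega>) \<longlonglongrightarrow> 0)"

end

theory Submission
  imports Defs
begin

text \<open>
  For \<open>D \<ge> 1\<close> the tapered logarithm is the integral of \<open>1 / t\<close> over \<open>t \<in> [1/D, D]\<close>, \<open>t < x\<close>, up to the
  constant \<open>ln (1/D)\<close>. By Tonelli its integrals against two laws differ by at most \<open>D\<close> times their
  Wasserstein distance, and for \<open>D = n\<^sup>s\<close> the assumed rate sends this to zero. Weak convergence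
  forces \<open>P\<close> onto the interval \<open>[cl, cu]\<close>, where the tapered logarithm eventually equals \<open>ln\<close>;
  it also gives the limit of the entropy, which is minus the integral of \<open>ln\<close> against \<open>rare_law p n\<close>.
  The log-probability is an average of independent bounded variables whose mean is minus the
  entropy; since nothing is known about the joint law of different rows, the strong law comes from
  Hoeffding's inequality and the Borel-Cantelli lemma.
\<close>

section \<open>The tapered logarithm\<close>

lemma inverse_le_self:
  fixes D :: real
  assumes "D \<ge> 1" shows "1 / D \<le> D"
  using assms by (simp add: divide_le_eq mult_ge1_I order_trans[of _ 1])

text \<open>Since \<open>1 / D \<le> D\<close>, tapering amounts to clamping the argument to
  [1/D, D] before taking \<open>ln\<close>. The clamped argument stays positive, so measurability,
  continuity and the bounds below are read off this form.\<close>

lemma tapered_ln_eq_clamp: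
  assumes "D \<ge> 1"
  shows "tapered ln D x = ln (max (1 / D) (min x D))"
  using inverse_le_self[OF assms] by (auto simp: tapered_def max_def min_def)

lemma tapered_ln_borel [measurable]:
  assumes "D \<ge> 1" shows "tapered ln D \<in> borel_measurable borel"
  unfolding tapered_ln_eq_clamp[OF assms, abs_def] by simp

lemma tapered_ln_eq_ln: "1 / D \<le> x \<Longrightarrow> x \<le> D \<Longrightarrow> tapered ln D x = ln x"
  by (simp add: tapered_def)

lemma isCont_tapered_ln:
  assumes "D \<ge> 1" shows "isCont (tapered ln D) x"
proof -
  have "max (1 / D) (min x D) > 0" using assms by (simp add: less_max_iff_disj)
  then show ?thesis
    unfolding tapered_ln_eq_clamp[OF assms, abs_def]
    by (intro continuous_intros) auto
qed

lemma tapered_ln_ge: "D \<ge> 1 \<Longrightarrow> ln (1 / D) \<le> tapered ln D x"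
  by (simp only: tapered_ln_eq_clamp, subst ln_le_cancel_iff) (auto simp: less_max_iff_disj)

lemma tapered_ln_le:
  assumes "D \<ge> 1" shows "tapered ln D x \<le> ln D"
  using assms inverse_le_self[OF assms] unfolding tapered_ln_eq_clamp[OF assms]
  by (subst ln_le_cancel_iff) (auto simp: less_max_iff_disj)

lemma abs_tapered_ln_le:
  assumes "D \<ge> 1" shows "norm (tapered ln D x) \<le> ln D"
  using tapered_ln_ge[OF assms, of x] tapered_ln_le[OF assms, of x] assms
  by (auto simp: ln_div abs_le_iff)

lemma (in real_distribution) integrable_tapered_ln:
  assumes "D \<ge> 1" shows "integrable M (tapered ln D)"
  by (rule integrable_const_bound[of _ "ln D"])
    (use assms abs_tapered_ln_le[OF assms] tapered_ln_borel[OF assms] in auto)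

lemma set_lebesgue_integral_full:
  assumes "AE x in Q. x \<in> B" "f \<in> borel_measurable Q" "B \<in> sets Q"
  shows "(LINT x:B|Q. f x) = integral\<^sup>L Q f"
  unfolding set_lebesgue_integral_def
  by (rule integral_cong_AE) (use assms in \<open>auto elim!: eventually_mono\<close>)

text \<open>Once D reaches both 1/cl and cu, the taper changes nothing on [cl, cu], and the law has
  no mass elsewhere. This exchanges the unbounded \<open>ln\<close> for a bounded continuous
  function.\<close>

lemma (in real_distribution) set_integral_ln_eq_tapered:
  assumes supp: "AE x in M. x \<in> {cl..cu}" and cl: "cl > 0"
    and D: "D \<ge> 1" "1 / cl \<le> D" "cu \<le> D"
  shows "(LINT x:{cl..cu}|M. ln x) = expectation (tapered ln D)"
proof -
  have "1 / D \<le> cl" using cl D(1,2) by (simp add: divide_le_eq mult.commute)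
  then have "tapered ln D x = ln x" if "x \<in> {cl..cu}" for x
    using that D(3) by (intro tapered_ln_eq_ln) auto
  then have "(LINT x:{cl..cu}|M. ln x) = (LINT x:{cl..cu}|M. tapered ln D x)"
    by (intro set_lebesgue_integral_cong) auto
  also have "\<dots> = expectation (tapered ln D)"
    using supp tapered_ln_borel[OF D(1)] by (intro set_lebesgue_integral_full) auto
  finally show ?thesis .
qed

section \<open>Tapered logarithm and Wasserstein distance\<close>

text \<open>The kernel 1/t is integrated up to the clamped point. Writing the upper limit as
  \<open>indicator {t<..} x\<close> isolates the dependence on x, so that averaging over x produces
  tail probabilities.\<close>

lemma tapered_ln_layer_cake:
  assumes D: "D \<ge> 1"
  shows "ennreal (tapered ln D x - ln (1 / D)) =
    (\<integral>\<^sup>+t. ennreal (indicator {1 / D..D} t / t) * indicator {t<..} x \<partial>lborel)"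
proof -
  define y where "y = max (1 / D) (min x D)"
  have pos: "1 / D > 0" using D by simp
  have y: "1 / D \<le> y" by (simp add: y_def)
  have "(\<integral>\<^sup>+t. ennreal (1 / t) * indicator {1 / D..y} t \<partial>lborel) = ennreal (ln y - ln (1 / D))"
  proof (rule nn_integral_FTC_Icc)
    fix t assume "t \<in> {1 / D..y}"
    then have "t > 0" using less_le_trans[OF pos, of t] by simp
    then show "(ln has_real_derivative 1 / t) (at t)" "0 \<le> 1 / t"
      by (auto intro!: derivative_eq_intros)
  qed (use y in auto)
  moreover have "(\<integral>\<^sup>+t. ennreal (1 / t) * indicator {1 / D..y} t \<partial>lborel) =
    (\<integral>\<^sup>+t. ennreal (indicator {1 / D..D} t / t) * indicator {t<..} x \<partial>lborel)"
  proof (rule nn_integral_cong_AE)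
    \<comment> \<open>The integrands can disagree only at t = x, because the interval is closed
      while \<open>t < x\<close> is strict, and at t = 1/D, because for x \<le> 1/D the interval
      shrinks to that point.\<close>
    have "AE t in lborel. t \<noteq> x" "AE t in lborel. t \<noteq> 1 / D" by (rule AE_lborel_singleton)+
    then show "AE t in lborel. ennreal (1 / t) * indicator {1 / D..y} t =
        ennreal (indicator {1 / D..D} t / t) * indicator {t<..} x"
      by eventually_elim (use inverse_le_self[OF D] in \<open>auto simp: y_def max_def min_def split: split_indicator\<close>)
  qed
  ultimately show ?thesis by (simp add: tapered_ln_eq_clamp[OF D] y_def)
qed

text \<open>Averaging the layer-cake formula and exchanging the integrals turns the indicator into
  the tail \<open>1 - cdf M t\<close>. The law then enters only through its cdf, as it does in the
  Wasserstein distance.\<close>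

lemma (in real_distribution) nn_integral_tapered_ln:
  assumes D: "D \<ge> 1"
  shows "ennreal (expectation (tapered ln D) - ln (1 / D)) =
    (\<integral>\<^sup>+t. ennreal (indicator {1 / D..D} t / t) * ennreal (1 - cdf M t) \<partial>lborel)"
proof -
  note [measurable] = tapered_ln_borel[OF D]
  interpret pair_sigma_finite M lborel ..
  have "expectation (tapered ln D) - ln (1 / D) = (LINT x|M. tapered ln D x - ln (1 / D))"
    using integrable_tapered_ln[OF D] prob_space by simp
  \<comment> \<open>The shift by \<open>ln (1 / D)\<close>, the minimum of the tapered logarithm,
    makes the integrand nonnegative.\<close>
  also have "ennreal \<dots> = (\<integral>\<^sup>+x. ennreal (tapered ln D x - ln (1 / D)) \<partial>M)"
    using integrable_tapered_ln[OF D] tapered_ln_ge[OF D]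
    by (intro nn_integral_eq_integral[symmetric]) auto
  also have "\<dots> = (\<integral>\<^sup>+x. \<integral>\<^sup>+t. ennreal (indicator {1 / D..D} t / t) * indicator {t<..} x \<partial>lborel \<partial>M)"
    by (simp only: tapered_ln_layer_cake[OF D])
  also have "\<dots> = (\<integral>\<^sup>+t. \<integral>\<^sup>+x. ennreal (indicator {1 / D..D} t / t) * indicator {t<..} x \<partial>M \<partial>lborel)"
  proof (rule Fubini'[symmetric])
    have "Measurable.pred (M \<Otimes>\<^sub>M lborel) (\<lambda>(x, t). t < x)" by measurable
    then have "(\<lambda>z. ennreal (indicator {1 / D..D} (snd z) / snd z) *
        indicator {z. snd z < fst z} z) \<in> borel_measurable (M \<Otimes>\<^sub>M lborel)"
      by measurable
    then show "(\<lambda>(x, t). ennreal (indicator {1 / D..D} t / t) * indicator {t<..} x)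
        \<in> borel_measurable (M \<Otimes>\<^sub>M lborel)"
      by (rule measurable_cong[THEN iffD1, rotated]) (auto split: split_indicator)
  qed
  also have "\<dots> = (\<integral>\<^sup>+t. ennreal (indicator {1 / D..D} t / t) * ennreal (1 - cdf M t) \<partial>lborel)"
  proof (rule nn_integral_cong)
    fix t
    have "emeasure M {t<..} = ennreal (1 - cdf M t)"
      using prob_compl[of "{..t}"] by (simp add: emeasure_eq_measure cdf_def Compl_atMost flip: Compl_eq_Diff_UNIV)
    then show "(\<integral>\<^sup>+x. ennreal (indicator {1 / D..D} t / t) * indicator {t<..} x \<partial>M) =
      ennreal (indicator {1 / D..D} t / t) * ennreal (1 - cdf M t)"
      by (subst nn_integral_cmult) auto
  qed
  finally show ?thesis .
qed

lemma cdf_borel_measurable: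
  assumes "real_distribution Q" shows "cdf Q \<in> borel_measurable borel"
proof -
  interpret real_distribution Q by fact
  show ?thesis by (intro borel_measurable_mono monoI cdf_nondecreasing)
qed

lemma wasserstein_commute: "wasserstein Q R = wasserstein R Q"
  by (simp add: wasserstein_def abs_minus_commute)

text \<open>The tails of Q exceed those of R by at most the distance of the cdfs, and the kernel
  weighs this by at most D. The bound is one-sided so that nothing is subtracted in
  \<open>ennreal\<close>.\<close>

lemma expectation_tapered_ln_le:
  assumes Q: "real_distribution Q" and R: "real_distribution R" and D: "D \<ge> 1"
  shows "ennreal (integral\<^sup>L Q (tapered ln D) - ln (1 / D)) \<le>
    ennreal (integral\<^sup>L R (tapered ln D) - ln (1 / D)) + ennreal D * wasserstein Q R"
proof -
  interpret Q: real_distribution Q by fact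
  interpret R: real_distribution R by fact
  note [measurable] = cdf_borel_measurable[OF Q] cdf_borel_measurable[OF R]
  let ?k = "\<lambda>t. ennreal (indicator {1 / D..D} t / t)"
  \<comment> \<open>On [1/D, D] one has 1/t \<le> D, and this interval lies in the half-line over
    which the Wasserstein distance integrates.\<close>
  have k: "?k t \<le> ennreal D * indicator {0..} t" for t
  proof (cases "t \<in> {1 / D..D}")
    case True
    moreover have "1 / D > 0" using D by simp
    ultimately have "t > 0" using less_le_trans[of 0 "1 / D" t] by simp
    with True D show ?thesis by (auto simp: field_simps intro!: ennreal_leI)
  qed auto
  have "ennreal (integral\<^sup>L Q (tapered ln D) - ln (1 / D)) =
      (\<integral>\<^sup>+t. ?k t * ennreal (1 - cdf Q t) \<partial>lborel)"
    by (rule Q.nn_integral_tapered_ln[OF D])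
  also have "\<dots> \<le> (\<integral>\<^sup>+t. ?k t * ennreal (1 - cdf R t) +
      ennreal D * (ennreal \<bar>cdf Q t - cdf R t\<bar> * indicator {0..} t) \<partial>lborel)"
  proof (rule nn_integral_mono)
    fix t
    have "ennreal (1 - cdf Q t) \<le> ennreal ((1 - cdf R t) + \<bar>cdf Q t - cdf R t\<bar>)"
      by (rule ennreal_leI) auto
    also have "\<dots> = ennreal (1 - cdf R t) + ennreal \<bar>cdf Q t - cdf R t\<bar>"
      using R.cdf_bounded_prob[of t] by (intro ennreal_plus) auto
    finally have "?k t * ennreal (1 - cdf Q t) \<le>
        ?k t * ennreal (1 - cdf R t) + ?k t * ennreal \<bar>cdf Q t - cdf R t\<bar>"
      by (metis distrib_left mult_left_mono zero_le)
    also have "\<dots> \<le> ?k t * ennreal (1 - cdf R t) +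
        (ennreal D * indicator {0..} t) * ennreal \<bar>cdf Q t - cdf R t\<bar>"
      by (intro add_left_mono mult_right_mono k) auto
    finally show "?k t * ennreal (1 - cdf Q t) \<le> ?k t * ennreal (1 - cdf R t) +
        ennreal D * (ennreal \<bar>cdf Q t - cdf R t\<bar> * indicator {0..} t)"
      by (simp add: mult_ac)
  qed
  also have "\<dots> = (\<integral>\<^sup>+t. ?k t * ennreal (1 - cdf R t) \<partial>lborel) +
      ennreal D * wasserstein Q R"
    unfolding wasserstein_def by (subst nn_integral_add) (auto simp: nn_integral_cmult)
  also have "(\<integral>\<^sup>+t. ?k t * ennreal (1 - cdf R t) \<partial>lborel) =
      ennreal (integral\<^sup>L R (tapered ln D) - ln (1 / D))"
    by (rule R.nn_integral_tapered_ln[OF D, symmetric])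
  finally show ?thesis .
qed

text \<open>The one-sided bound is applied in both directions. An infinite right-hand side is
  trivial; otherwise it is a real r.\<close>

lemma abs_expectation_tapered_ln_diff_le:
  assumes Q: "real_distribution Q" and R: "real_distribution R" and D: "D \<ge> 1"
  shows "ennreal \<bar>integral\<^sup>L Q (tapered ln D) - integral\<^sup>L R (tapered ln D)\<bar> \<le>
    ennreal D * wasserstein Q R"
proof (cases "ennreal D * wasserstein Q R" rule: ennreal_cases)
  case (real r)
  \<comment> \<open>As \<open>ennreal\<close> truncates negative reals to 0, nonnegativity is what
    allows the right-hand sums to be merged and compared as reals.\<close>
  have nonneg: "integral\<^sup>L S (tapered ln D) - ln (1 / D) \<ge> 0" if "real_distribution S" for S
  proof -
    interpret real_distribution S by fact
    have "(LINT x|S. ln (1 / D)) \<le> integral\<^sup>L S (tapered ln D)"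
      using integrable_tapered_ln[OF D] tapered_ln_ge[OF D] by (intro integral_mono) auto
    then show ?thesis using prob_space by simp
  qed
  have "integral\<^sup>L Q (tapered ln D) \<le> integral\<^sup>L R (tapered ln D) + r"
    using expectation_tapered_ln_le[OF Q R D] real nonneg[OF R]
    by (simp flip: ennreal_plus add: ennreal_le_iff)
  moreover have "integral\<^sup>L R (tapered ln D) \<le> integral\<^sup>L Q (tapered ln D) + r"
    using expectation_tapered_ln_le[OF R Q D] real nonneg[OF Q]
    by (simp flip: ennreal_plus add: ennreal_le_iff wasserstein_commute[of R])
  ultimately show ?thesis using real by (auto intro!: ennreal_leI)
qed auto

section \<open>A strong law for rows with arbitrary joint dependence\<close>

text \<open>Hoeffding's inequality makes the deviation probability of row n geometrically small in
  n. The first Borel-Cantelli lemma asks only for summability, hence nothing about how the rows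
  depend on each other.\<close>

lemma bounded_rows_strong_law:
  fixes Z :: "nat \<Rightarrow> nat \<Rightarrow> 'w \<Rightarrow> real"
  assumes M: "prob_space M"
    and indep: "\<And>n. n \<ge> 1 \<Longrightarrow> prob_space.indep_vars M (\<lambda>_. borel) (Z n) {1..n}"
    and bounded: "\<And>n i. n \<ge> 1 \<Longrightarrow> i \<in> {1..n} \<Longrightarrow> AE x in M. Z n i x \<in> {a..b}"
    and less: "a < b"
  shows "AE x in M. (\<lambda>n. ((\<Sum>i=1..n. Z n i x) - (\<Sum>i=1..n. integral\<^sup>L M (Z n i))) / real n) \<longlonglongrightarrow> 0"
proof -
  interpret prob_space M by fact
  have meas: "random_variable borel (Z (Suc n) i)" if "i \<in> {1..Suc n}" for n i
    using indep[of "Suc n"] that unfolding indep_vars_def by auto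
  define m where "m n = (\<Sum>i=1..n. expectation (Z n i))" for n
  \<comment> \<open>The event that the average of row \<open>Suc n\<close> is off by at least e; the
    shift skips the unconstrained row 0.\<close>
  define E where "E e n = {x \<in> space M. \<bar>(\<Sum>i=1..Suc n. Z (Suc n) i x) - m (Suc n)\<bar> \<ge> real (Suc n) * e}"
    for e n
  have E_sets [measurable]: "E e n \<in> events" for e n
    unfolding E_def using meas by measurable
  have E_le: "prob (E e n) \<le> 2 * exp (- (2 * e\<^sup>2 / (b - a)\<^sup>2)) ^ Suc n" if e: "e > 0" for e n
  proof -
    interpret indep_interval_bounded_random_variables M "{1..Suc n}" "Z (Suc n)" "\<lambda>_. a" "\<lambda>_. b"
      by unfold_locales (use indep[of "Suc n"] bounded[of "Suc n"] in auto)
    interpret H: Hoeffding_ineq M "{1..Suc n}" "Z (Suc n)" "\<lambda>_. a" "\<lambda>_. b" "m (Suc n)"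
      by unfold_locales (simp add: m_def)
    have "prob (E e n) \<le> 2 * exp (- 2 * (real (Suc n) * e)\<^sup>2 / (\<Sum>i\<in>{1..Suc n}. (b - a)\<^sup>2))"
      unfolding E_def by (rule H.Hoeffding_ineq_abs_ge) (use e less in auto)
    \<comment> \<open>All intervals have the same length, so one factor \<open>Suc n\<close> cancels
      and the bound becomes a geometric sequence.\<close>
    also have "- 2 * (real (Suc n) * e)\<^sup>2 / (\<Sum>i\<in>{1..Suc n}. (b - a)\<^sup>2) =
        real (Suc n) * (- (2 * e\<^sup>2 / (b - a)\<^sup>2))"
    proof -
      have "(b - a)\<^sup>2 > 0" using less by simp
      then show ?thesis by (simp add: divide_simps power2_eq_square del: of_nat_Suc)
    qed
    finally show ?thesis by (simp only: exp_of_nat_mult)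
  qed
  have "AE x in M. \<forall>\<^sub>F n in sequentially. x \<in> space M - E e n" if e: "e > 0" for e
  proof (rule borel_cantelli_AE1)
    have "summable (\<lambda>n. 2 * exp (- (2 * e\<^sup>2 / (b - a)\<^sup>2)) ^ Suc n)"
      using e less by (intro summable_mult summable_Suc_iff[THEN iffD2] summable_geometric) auto
    then show "summable (\<lambda>n. prob (E e n))"
      by (rule summable_comparison_test') (use E_le[OF e] in auto)
  qed (auto simp: emeasure_eq_measure)
  \<comment> \<open>Countably many thresholds 1/(k+1) suffice and allow a single null set for all of
    them.\<close>
  then have "AE x in M. \<forall>k. \<forall>\<^sub>F n in sequentially. x \<in> space M - E (1 / real (Suc k)) n"
    by (subst AE_all_countable) auto
  then show ?thesis
  proof eventually_elim
    case (elim x)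
    have "(\<lambda>n. ((\<Sum>i=1..Suc n. Z (Suc n) i x) - m (Suc n)) / real (Suc n)) \<longlonglongrightarrow> 0"
    proof (rule tendstoI)
      fix e :: real assume "e > 0"
      then obtain k where k: "1 / real (Suc k) < e" using nat_approx_posE by blast
      from elim have "\<forall>\<^sub>F n in sequentially. x \<in> space M - E (1 / real (Suc k)) n" by blast
      then show "\<forall>\<^sub>F n in sequentially.
        dist (((\<Sum>i=1..Suc n. Z (Suc n) i x) - m (Suc n)) / real (Suc n)) 0 < e"
      proof eventually_elim
        case (elim n)
        then have "\<bar>(\<Sum>i=1..Suc n. Z (Suc n) i x) - m (Suc n)\<bar> < real (Suc n) * (1 / real (Suc k))"
          by (auto simp: E_def)
        also have "\<dots> < real (Suc n) * e" using k by (intro mult_strict_left_mono) auto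
        finally show ?case
          by (simp add: dist_real_def abs_divide divide_less_eq mult.commute del: of_nat_Suc sum.cl_ivl_Suc)
      qed
    qed
    then show ?case unfolding m_def by (rule LIMSEQ_imp_Suc)
  qed
qed


section \<open>Limit law and normalized entropy of the source\<close>

lemma rare_law_real_distribution: "real_distribution (rare_law p n)"
  unfolding rare_law_def by (rule prob_space.real_distribution_distr[OF measure_pmf.prob_space_axioms]) simp

lemma integral_rare_law:
  assumes "finite B" "set_pmf (p n) \<subseteq> B" "f \<in> borel_measurable borel"
  shows "integral\<^sup>L (rare_law p n) f = (\<Sum>a\<in>B. f (real n * pmf (p n) a) * pmf (p n) a)"
proof -
  have "integral\<^sup>L (rare_law p n) f = (LINT a|measure_pmf (p n). f (real n * pmf (p n) a))"
    unfolding rare_law_def by (rule integral_distr) (use assms in auto)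
  also have "\<dots> = (\<Sum>a\<in>B. f (real n * pmf (p n) a) * pmf (p n) a)"
    by (rule integral_measure_pmf_real) (use assms in auto)
  finally show ?thesis .
qed

lemma rare_events_source_bounds:
  assumes "rare_events_source A p cl cu P" "n \<ge> 1" "a \<in> A n"
  shows "real n * pmf (p n) a \<in> {cl..cu}"
  using assms by (force simp: rare_events_source_def field_simps)

text \<open>The test function is the distance to [cl, cu] truncated at 1. It is bounded and
  continuous and has integral 0 under each \<open>rare_law p n\<close> with n \<ge> 1, hence also
  under P; being nonnegative, it vanishes almost surely.\<close>

lemma rare_events_source_limit_support:
  assumes source: "rare_events_source A p cl cu P"
  shows "AE x in P. x \<in> {cl..cu}"
proof -
  interpret real_distribution P using source by (simp add: rare_events_source_def)
  define f where "f x = min 1 (max 0 (max (cl - x) (x - cu)))" for x :: real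
  have [measurable]: "f \<in> borel_measurable borel" unfolding f_def by measurable
  have "(\<lambda>n. integral\<^sup>L (rare_law p n) f) \<longlonglongrightarrow> integral\<^sup>L P f"
  proof (rule weak_conv_imp_integral_bdd_continuous_conv[where B = 1])
    show "isCont f x" for x unfolding f_def by (intro continuous_intros)
  qed (use source in \<open>auto simp: f_def rare_events_source_def rare_law_real_distribution\<close>)
  moreover have "\<forall>\<^sub>F n in sequentially. integral\<^sup>L (rare_law p n) f = 0"
  proof (rule eventually_sequentiallyI)
    fix n :: nat assume n: "1 \<le> n"
    have "integral\<^sup>L (rare_law p n) f = (\<Sum>a\<in>A n. f (real n * pmf (p n) a) * pmf (p n) a)"
      by (rule integral_rare_law) (use source n in \<open>auto simp: rare_events_source_def\<close>)
    also have "\<dots> = 0"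
      using rare_events_source_bounds[OF source n] by (intro sum.neutral) (auto simp: f_def)
    finally show "integral\<^sup>L (rare_law p n) f = 0" .
  qed
  ultimately have "integral\<^sup>L P f = 0"
    by (rule LIMSEQ_unique[OF _ tendsto_eventually])
  moreover have "integrable P f"
    by (rule integrable_const_bound[of _ 1]) (auto simp: f_def)
  ultimately have "AE x in P. f x = 0"
    by (subst (asm) integral_nonneg_eq_0_iff_AE) (auto simp: f_def)
  then show ?thesis by eventually_elim (auto simp: f_def min_def max_def split: if_splits)
qed

text \<open>The masses on \<open>A n\<close> sum to one, so \<open>ln n\<close> can be moved inside
  the entropy sum. The result is minus the mean of \<open>ln\<close> under
  \<open>rare_law p n\<close>, to which weak convergence applies.\<close>

lemma normalized_entropy_eq:
  assumes source: "rare_events_source A p cl cu P" and n: "n \<ge> 1"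
  shows "normalized_entropy A p n = - (\<Sum>a\<in>A n. ln (real n * pmf (p n) a) * pmf (p n) a)"
proof -
  have pos: "pmf (p n) a > 0" if "a \<in> A n" for a
  proof -
    have "cl / real n > 0" "cl / real n \<le> pmf (p n) a"
      using source n that by (auto simp: rare_events_source_def)
    then show ?thesis by linarith
  qed
  have "(\<Sum>a\<in>A n. pmf (p n) a) = 1"
    using source n by (intro sum_pmf_eq_1) (auto simp: rare_events_source_def)
  then have "ln (real n) = (\<Sum>a\<in>A n. ln (real n) * pmf (p n) a)"
    by (simp flip: sum_distrib_left)
  moreover have "(\<Sum>a\<in>A n. ln (real n * pmf (p n) a) * pmf (p n) a) =
      (\<Sum>a\<in>A n. ln (real n) * pmf (p n) a) + (\<Sum>a\<in>A n. pmf (p n) a * ln (pmf (p n) a))"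
    using pos n by (subst sum.distrib[symmetric], intro sum.cong) (auto simp: ln_mult algebra_simps)
  ultimately show ?thesis
    by (simp add: normalized_entropy_def pmf_entropy_def)
qed

lemma normalized_entropy_tendsto:
  assumes source: "rare_events_source A p cl cu P"
  shows "normalized_entropy A p \<longlonglongrightarrow> - (LINT x:{cl..cu}|P. ln x)"
proof -
  interpret real_distribution P using source by (simp add: rare_events_source_def)
  \<comment> \<open>A fixed D, large enough that the taper is inactive on [cl, cu], where P and all
    the laws \<open>rare_law p n\<close> with n \<ge> 1 live.\<close>
  define D where "D = max 1 (max (1 / cl) cu)"
  have D: "D \<ge> 1" by (simp add: D_def)
  have cl: "cl > 0" using source by (simp add: rare_events_source_def)
  have "1 / cl \<le> D" by (simp add: D_def)
  then have "1 / D \<le> cl" using cl D by (simp add: field_simps)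
  then have eq: "tapered ln D x = ln x" if "x \<in> {cl..cu}" for x
    using that by (intro tapered_ln_eq_ln) (auto simp: D_def)
  have lim: "(LINT x:{cl..cu}|P. ln x) = integral\<^sup>L P (tapered ln D)"
    by (rule set_integral_ln_eq_tapered[OF rare_events_source_limit_support[OF source] cl D])
      (auto simp: D_def)
  have "(\<lambda>n. integral\<^sup>L (rare_law p n) (tapered ln D)) \<longlonglongrightarrow> integral\<^sup>L P (tapered ln D)"
    by (rule weak_conv_imp_integral_bdd_continuous_conv[where B = "ln D"])
      (use source isCont_tapered_ln[OF D] abs_tapered_ln_le[OF D]
        in \<open>auto simp: rare_events_source_def rare_law_real_distribution\<close>)
  then have "(\<lambda>n. - integral\<^sup>L (rare_law p n) (tapered ln D)) \<longlonglongrightarrow> - (LINT x:{cl..cu}|P. ln x)"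
    unfolding lim by (rule tendsto_minus)
  moreover have "\<forall>\<^sub>F n in sequentially.
      - integral\<^sup>L (rare_law p n) (tapered ln D) = normalized_entropy A p n"
  proof (rule eventually_sequentiallyI)
    fix n :: nat assume n: "1 \<le> n"
    have "integral\<^sup>L (rare_law p n) (tapered ln D) =
        (\<Sum>a\<in>A n. tapered ln D (real n * pmf (p n) a) * pmf (p n) a)"
      by (rule integral_rare_law)
        (use source n tapered_ln_borel[OF D] in \<open>auto simp: rare_events_source_def\<close>)
    also have "\<dots> = (\<Sum>a\<in>A n. ln (real n * pmf (p n) a) * pmf (p n) a)"
      using rare_events_source_bounds[OF source n] by (intro sum.cong) (auto simp: eq)
    finally show "- integral\<^sup>L (rare_law p n) (tapered ln D) = normalized_entropy A p n"
      by (simp add: normalized_entropy_eq[OF source n])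
  qed
  ultimately show ?thesis by (rule Lim_transform_eventually)
qed

section \<open>Log-probability of the sample\<close>

text \<open>There are countably many pairs (n, i), so one null set serves all. Off it every letter
  has positive probability and lies in \<open>A n\<close>, where the source bounds hold.\<close>

lemma AE_sample_in_support:
  assumes "iid_rows M p X"
  shows "AE \<omega> in M. \<forall>n\<ge>1. \<forall>i\<in>{1..n}. X n i \<omega> \<in> set_pmf (p n)"
proof -
  interpret prob_space M using assms by (simp add: iid_rows_def)
  have "AE \<omega> in M. X n i \<omega> \<in> set_pmf (p n)" if n: "n \<ge> 1" and i: "i \<in> {1..n}" for n i
  proof -
    have "indep_vars (\<lambda>_. count_space UNIV) (X n) {1..n}"
      using assms n by (simp add: iid_rows_def)
    then have meas: "X n i \<in> measurable M (count_space UNIV)"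
      using i by (auto simp: indep_vars_def)
    have "AE a in distr M (count_space UNIV) (X n i). a \<in> set_pmf (p n)"
      using assms n i unfolding iid_rows_def by (metis AE_measure_pmf)
    then show ?thesis using meas by (simp add: AE_distr_iff)
  qed
  then show ?thesis by (simp add: AE_all_countable AE_ball_countable)
qed

lemma normalized_logprob_tendsto:
  assumes source: "rare_events_source A p cl cu P" and sampling: "iid_rows M p X"
  shows "AE \<omega> in M. (\<lambda>n. normalized_logprob p n (sample X n \<omega>))
    \<longlonglongrightarrow> (LINT x:{cl..cu}|P. ln x)"
proof -
  interpret prob_space M using sampling by (simp add: iid_rows_def)
  \<comment> \<open>For n \<ge> 1 the row averages of \<open>Z\<close> are almost surely the
    normalized log-probability, and each entry has mean minus the normalized entropy.\<close>
  define Z where "Z n i \<omega> = ln (real n * pmf (p n) (X n i \<omega>))" for n i \<omega>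
  have indep: "indep_vars (\<lambda>_. count_space UNIV) (X n) {1..n}" if "n \<ge> 1" for n
    using sampling that by (simp add: iid_rows_def)
  have sub: "set_pmf (p n) \<subseteq> A n" and fin: "finite (A n)" if "n \<ge> 1" for n
    using source that by (auto simp: rare_events_source_def)
  have cl: "cl > 0" using source by (simp add: rare_events_source_def)
  have expect: "expectation (Z n i) = - normalized_entropy A p n"
    if n: "n \<ge> 1" and i: "i \<in> {1..n}" for n i
  proof -
    have "X n i \<in> measurable M (count_space UNIV)"
      using i indep[OF n] by (auto simp: indep_vars_def)
    then have "expectation (Z n i) =
        (LINT a|distr M (count_space UNIV) (X n i). ln (real n * pmf (p n) a))"
      unfolding Z_def by (subst integral_distr) auto
    also have "\<dots> = (LINT a|measure_pmf (p n). ln (real n * pmf (p n) a))"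
      using sampling n i by (simp add: iid_rows_def)
    also have "\<dots> = (\<Sum>a\<in>A n. ln (real n * pmf (p n) a) * pmf (p n) a)"
      by (rule integral_measure_pmf_real) (use sub[OF n] fin[OF n] in auto)
    finally show ?thesis by (simp add: normalized_entropy_eq[OF source n])
  qed
  have "AE \<omega> in M. (\<lambda>n. ((\<Sum>i=1..n. Z n i \<omega>) - (\<Sum>i=1..n. expectation (Z n i))) / real n)
      \<longlonglongrightarrow> 0"
  \<comment> \<open>The extra 1 keeps the interval nondegenerate when cl = cu.\<close>
  proof (rule bounded_rows_strong_law[where a = "ln cl" and b = "ln cu + 1"])
    show "indep_vars (\<lambda>_. borel) (Z n) {1..n}" if "n \<ge> 1" for n
      using indep_vars_compose2[OF indep[OF that],
          of "\<lambda>_ a. ln (real n * pmf (p n) a)" "\<lambda>_. borel"]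
      by (simp add: Z_def[abs_def])
    show "AE \<omega> in M. Z n i \<omega> \<in> {ln cl..ln cu + 1}" if n: "n \<ge> 1" and i: "i \<in> {1..n}" for n i
      using AE_sample_in_support[OF sampling]
    proof eventually_elim
      case (elim \<omega>)
      then have "real n * pmf (p n) (X n i \<omega>) \<in> {cl..cu}"
        using rare_events_source_bounds[OF source n] sub[OF n] n i by blast
      then have b: "cl \<le> real n * pmf (p n) (X n i \<omega>)" "real n * pmf (p n) (X n i \<omega>) \<le> cu"
        by auto
      have "ln cl \<le> Z n i \<omega>" "Z n i \<omega> \<le> ln cu"
        unfolding Z_def using b cl by (intro ln_mono; linarith)+
      then show ?case by simp
    qed
    have "ln cl \<le> ln cu" using source by (simp add: rare_events_source_def)
    then show "ln cl < ln cu + 1" by simp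
  qed (rule prob_space_axioms)
  then show ?thesis using AE_sample_in_support[OF sampling]
  proof eventually_elim
    case (elim \<omega>)
    have "(\<lambda>n. ((\<Sum>i=1..n. Z n i \<omega>) - (\<Sum>i=1..n. expectation (Z n i))) / real n +
        - normalized_entropy A p n) \<longlonglongrightarrow> 0 + - (- (LINT x:{cl..cu}|P. ln x))"
      by (intro tendsto_add tendsto_minus elim normalized_entropy_tendsto[OF source])
    moreover have "\<forall>\<^sub>F n in sequentially.
      ((\<Sum>i=1..n. Z n i \<omega>) - (\<Sum>i=1..n. expectation (Z n i))) / real n +
        - normalized_entropy A p n = normalized_logprob p n (sample X n \<omega>)"
    proof (rule eventually_sequentiallyI)
      fix n :: nat assume n: "1 \<le> n"
      \<comment> \<open>Positive factors are required to split the logarithm of the product into a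
        sum.\<close>
      have nonzero: "pmf (p n) (X n i \<omega>) \<noteq> 0" if "i \<in> {1..n}" for i
        using elim(2) n that by (simp add: set_pmf_iff)
      have "seq_prob (p n) (sample X n \<omega>) = (\<Prod>i=1..n. pmf (p n) (X n i \<omega>))"
        unfolding seq_prob_def sample_def
        by (simp add: prod.distinct_set_conv_list[symmetric] atLeastLessThanSuc_atLeastAtMost
            o_def del: upt_Suc)
      then have "ln (seq_prob (p n) (sample X n \<omega>)) = (\<Sum>i=1..n. ln (pmf (p n) (X n i \<omega>)))"
        by (simp only:) (rule ln_prod[OF finite_atLeastAtMost nonzero])
      moreover have "(\<Sum>i=1..n. Z n i \<omega>) =
          real n * ln (real n) + (\<Sum>i=1..n. ln (pmf (p n) (X n i \<omega>)))"
      proof -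
        have "(\<Sum>i=1..n. Z n i \<omega>) = (\<Sum>i=1..n. ln (real n) + ln (pmf (p n) (X n i \<omega>)))"
          unfolding Z_def using nonzero n by (intro sum.cong) (auto simp: ln_mult)
        then show ?thesis by (simp add: sum.distrib)
      qed
      moreover have "(\<Sum>i=1..n. expectation (Z n i)) = real n * - normalized_entropy A p n"
        using expect[OF n] by simp
      ultimately show "((\<Sum>i=1..n. Z n i \<omega>) - (\<Sum>i=1..n. expectation (Z n i))) / real n +
          - normalized_entropy A p n = normalized_logprob p n (sample X n \<omega>)"
        using n by (simp add: normalized_logprob_def field_simps)
    qed
    ultimately show ?case using Lim_transform_eventually by fastforce
  qed
qed

section \<open>Convergence of the estimators\<close>

text \<open>A deterministic statement, to be applied to each outcome separately. The tapered means
  under \<open>Q n\<close> and P merge by the rate, and the mean under P eventually equals its limit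
  because the taper leaves [cl, cu] untouched.\<close>

lemma entropy_estimate_tendsto:
  assumes Q: "\<And>n. n \<ge> 1 \<Longrightarrow> nonneg_distribution (Q n)"
    and P: "real_distribution P" "AE x in P. x \<in> {cl..cu}" and cl: "cl > 0" and s: "s > 0"
    and rate: "(\<lambda>n. ennreal (real n powr s) * wasserstein (Q n) P) \<longlonglongrightarrow> 0"
  shows "(\<lambda>n. entropy_estimate s n (Q n)) \<longlonglongrightarrow> - (LINT x:{cl..cu}|P. ln x)"
proof -
  interpret P: real_distribution P by fact
  define g where "g n = integral\<^sup>L (Q n) (tapered ln (real n powr s))" for n
  define h where "h n = integral\<^sup>L P (tapered ln (real n powr s))" for n
  have D: "real n powr s \<ge> 1" if "n \<ge> 1" for n using that s by (simp add: ge_one_powr_ge_zero)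
  \<comment> \<open>The squeeze takes place in \<open>ennreal\<close>, since the Wasserstein
    distance may be infinite for some n.\<close>
  have "(\<lambda>n. ennreal \<bar>g n - h n\<bar>) \<longlonglongrightarrow> ennreal 0"
  proof (rule tendsto_sandwich[OF _ _ tendsto_const])
    show "\<forall>\<^sub>F n in sequentially. ennreal \<bar>g n - h n\<bar> \<le> ennreal (real n powr s) * wasserstein (Q n) P"
      using eventually_ge_at_top[of 1]
      by eventually_elim
        (use Q in \<open>auto simp: g_def h_def nonneg_distribution_def
          intro!: abs_expectation_tapered_ln_diff_le P D\<close>)
  qed (use rate in auto)
  then have "(\<lambda>n. \<bar>g n - h n\<bar>) \<longlonglongrightarrow> 0"
    by (subst (asm) tendsto_ennreal_iff) auto
  then have diff: "(\<lambda>n. g n - h n) \<longlonglongrightarrow> 0" by (rule tendsto_rabs_zero_cancel)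
  \<comment> \<open>The threshold beyond which tapering is inactive on [cl, cu];
    \<open>real n powr s\<close> passes it once n \<ge> \<open>c powr (1 / s)\<close>.\<close>
  define c where "c = max 1 (max (1 / cl) cu)"
  have "\<forall>\<^sub>F n in sequentially. c powr (1 / s) \<le> real n"
    using filterlim_real_sequentially by (simp only: filterlim_at_top)
  then have "\<forall>\<^sub>F n in sequentially. c \<le> real n powr s"
  proof eventually_elim
    case (elim n)
    then have "(c powr (1 / s)) powr s \<le> real n powr s"
      using s by (intro powr_mono2) auto
    then show ?case using s by (simp add: powr_powr c_def)
  qed
  then have h: "\<forall>\<^sub>F n in sequentially. (LINT x:{cl..cu}|P. ln x) = h n"
  proof eventually_elim
    case (elim n)
    then have "real n powr s \<ge> 1" "1 / cl \<le> real n powr s" "cu \<le> real n powr s"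
      by (auto simp: c_def)
    then show ?case
      unfolding h_def by (intro P.set_integral_ln_eq_tapered[OF P(2) cl])
  qed
  have "\<forall>\<^sub>F n in sequentially. - ((g n - h n) + (LINT x:{cl..cu}|P. ln x)) = entropy_estimate s n (Q n)"
    using h eventually_ge_at_top[of 1]
  proof eventually_elim
    case (elim n)
    interpret Q: real_distribution "Q n" using Q[OF elim(2)] by (simp add: nonneg_distribution_def)
    have "AE x in Q n. x \<in> {0..}"
      using Q[OF elim(2)] by (intro Q.AE_prob_1) (simp add: nonneg_distribution_def)
    then have "(LINT x:{0..}|Q n. tapered ln (real n powr s) x) = g n"
      unfolding g_def using tapered_ln_borel[OF D[OF elim(2)]]
      by (intro set_lebesgue_integral_full) auto
    then show ?case using elim(1) by (simp add: entropy_estimate_def)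
  qed
  moreover have "(\<lambda>n. - ((g n - h n) + (LINT x:{cl..cu}|P. ln x))) \<longlonglongrightarrow> - (0 + (LINT x:{cl..cu}|P. ln x))"
    by (intro tendsto_intros diff)
  ultimately show ?thesis using Lim_transform_eventually by fastforce
qed

theorem mainTheorem7:
  fixes A :: "nat \<Rightarrow> 'a set" and p :: "nat \<Rightarrow> 'a pmf" and cl cu s :: real
    and P :: "real measure" and M :: "'w measure"
    and X :: "nat \<Rightarrow> nat \<Rightarrow> 'w \<Rightarrow> 'a"
    and T :: "nat \<Rightarrow> 'a list \<Rightarrow> real measure"
  assumes source: "rare_events_source A p cl cu P"
    and sampling: "iid_rows M p X"
    and estimator: "measure_estimator A T"
    and s: "s > 0"
    and rate: "AE \<omega> in M.
      (\<lambda>n. ennreal (real n powr s) * wasserstein (T n (sample X n \<omega>)) P) \<longlonglongrightarrow> 0"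
  shows
    "(consistent_estimator M (\<lambda>n \<omega>. entropy_estimate s n (T n (sample X n \<omega>)))
        (\<lambda>n \<omega>. normalized_entropy A p n) \<and>
      (AE \<omega> in M. (\<lambda>n. entropy_estimate s n (T n (sample X n \<omega>)))
         \<longlonglongrightarrow> - (LINT x:{cl..cu}|P. ln x)) \<and>
      normalized_entropy A p \<longlonglongrightarrow> - (LINT x:{cl..cu}|P. ln x)) \<and>
     (consistent_estimator M (\<lambda>n \<omega>. logprob_estimate s n (T n (sample X n \<omega>)))
        (\<lambda>n \<omega>. normalized_logprob p n (sample X n \<omega>)) \<and>
      (AE \<omega> in M. (\<lambda>n. logprob_estimate s n (T n (sample X n \<omega>)))
         \<longlonglongrightarrow> (LINT x:{cl..cu}|P. ln x)) \<and>
      (AE \<omega> in M. (\<lambda>n. normalized_logprob p n (sample X n \<omega>))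
         \<longlonglongrightarrow> (LINT x:{cl..cu}|P. ln x)))"
proof -
  let ?L = "LINT x:{cl..cu}|P. ln x"
  have hat: "AE \<omega> in M. (\<lambda>n. entropy_estimate s n (T n (sample X n \<omega>))) \<longlonglongrightarrow> - ?L"
    using rate AE_sample_in_support[OF sampling]
  proof eventually_elim
    case (elim \<omega>)
    show ?case
    proof (rule entropy_estimate_tendsto)
      fix n :: nat assume n: "n \<ge> 1"
      have "set_pmf (p n) \<subseteq> A n" using source n by (simp add: rare_events_source_def)
      \<comment> \<open>\<open>T n\<close> is constrained only on words of length n over
        \<open>A n\<close>, so the outcome is taken outside the null set where some letter leaves
        the support.\<close>
      then have "sample X n \<omega> \<in> lists (A n)" "length (sample X n \<omega>) = n"
        using elim(2) n by (force simp: sample_def simp del: upt_Suc)+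
      then show "nonneg_distribution (T n (sample X n \<omega>))"
        using estimator n by (simp add: measure_estimator_def)
    qed (use source s elim(1) rare_events_source_limit_support[OF source]
        in \<open>auto simp: rare_events_source_def\<close>)
  qed
  have hatp: "AE \<omega> in M. (\<lambda>n. logprob_estimate s n (T n (sample X n \<omega>))) \<longlonglongrightarrow> ?L"
    using hat by eventually_elim (drule tendsto_minus, simp add: logprob_estimate_def)
  note ent = normalized_entropy_tendsto[OF source]
  note logp = normalized_logprob_tendsto[OF source sampling]
  have "consistent_estimator M (\<lambda>n \<omega>. entropy_estimate s n (T n (sample X n \<omega>)))
      (\<lambda>n \<omega>. normalized_entropy A p n)"
    \<comment> \<open>Estimator and target converge to the same limit, so their difference tends to
      0.\<close>
    unfolding consistent_estimator_def
    using hat by eventually_elim (use tendsto_diff[OF _ ent] in fastforce)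
  moreover have "consistent_estimator M (\<lambda>n \<omega>. logprob_estimate s n (T n (sample X n \<omega>)))
      (\<lambda>n \<omega>. normalized_logprob p n (sample X n \<omega>))"
    unfolding consistent_estimator_def
    using hatp logp by eventually_elim (drule (1) tendsto_diff, simp)
  ultimately show ?thesis using hat hatp ent logp by blast
qed

end
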